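(* Let $a,b,c,u,v,q$ be complex parameters (generic, so that no denominator below vanishes). For $n\ge 0$ put $K_1(n):=K(a,b,c,q^{-n},a,u,v,q)$. Define \[ \alpha_n:=\frac{(q\sqrt{a},-q\sqrt{a},a,b,c,qu,qa/u,qv,qa/v;q)_n}{(\sqrt{a},-\sqrt{a},qa/b,qa/c,u,a/u,v,a/v,q;q)_n}\left(\frac{-a}{bc}\right)^n q^{n(n-3)/2},\qquad \beta_n:=K_1(n)\,\frac{(aq/bc;q)_n}{(aq/b,aq/c,q;q)_n}. \] Then $(\alpha_n,\beta_n)$ is a Bailey pair relative to $a$.
   Context: Notation: $(x;q)_n=\prod_{k=0}^{n-1}(1-xq^k)$ and $(x_1,\dots,x_k;q)_n=(x_1;q)_n\cdots(x_k;q)_n$. A pair of sequences $(\alpha_n)_{n\ge0},(\beta_n)_{n\ge0}$ is a Bailey pair relative to $a$ if $\alpha_0=1$ and $\beta_n=\sum_{j=0}^{n}\frac{\alpha_j}{(q;q)_{n-j}(aq;q)_{n+j}}$ for all $n\ge0$. The function $K$: for complex $a,b,c,d,e,u,v$ and a base $p$, let $\sigma_1,\sigma_2,\sigma_3,\sigma_4$ be the elementary symmetric functions of $b,c,d,e$ (so $\sigma_1=b+c+d+e$, $\sigma_4=bcde$), and \[ K(a,b,c,d,e,u,v,p):=\frac{uv(\sigma_3-a\sigma_1)(p\sigma_3-a\sigma_1)a^2+(1-p)uv(a^2-\sigma_4)(a^2-\sigma_2a+\sigma_4)a+(u+v)(a+uv)(\sigma_3-a\sigma_1)(a^2-p\sigma_4)a+(u^2+a)(v^2+a)(a^2-\sigma_4)(a^2-p\sigma_4)}{(a^2-bcde)(a^2-bcde\,p)(1-u)(a-u)(1-v)(a-v)}.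 \] *)

theory Defs
  imports "HOL-Analysis.Analysis"
begin

definition qpoch :: "complex \<Rightarrow> complex \<Rightarrow> nat \<Rightarrow> complex" where
  "qpoch x q n = (\<Prod>k<n. 1 - x * q ^ k)"

definition qpochs :: "complex list \<Rightarrow> complex \<Rightarrow> nat \<Rightarrow> complex" where
  "qpochs xs q n = (\<Prod>x\<leftarrow>xs. qpoch x q n)"

definition bailey_pair ::
  "complex \<Rightarrow> complex \<Rightarrow> (nat \<Rightarrow> complex) \<Rightarrow> (nat \<Rightarrow> complex) \<Rightarrow> bool" where
  "bailey_pair a q \<alpha> \<beta> \<longleftrightarrow>
     \<alpha> 0 = 1 \<and>
     (\<forall>n. \<beta> n = (\<Sum>j\<le>n. \<alpha> j / (qpoch q q (n - j) * qpoch (a * q) q (n + j))))"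

definition K_denom ::
  "complex \<Rightarrow> complex \<Rightarrow> complex \<Rightarrow> complex \<Rightarrow> complex \<Rightarrow> complex \<Rightarrow> complex \<Rightarrow> complex \<Rightarrow> complex" where
  "K_denom a b c d e u v p =
     (a^2 - b*c*d*e) * (a^2 - b*c*d*e*p) * (1 - u) * (a - u) * (1 - v) * (a - v)"

definition K ::
  "complex \<Rightarrow> complex \<Rightarrow> complex \<Rightarrow> complex \<Rightarrow> complex \<Rightarrow> complex \<Rightarrow> complex \<Rightarrow> complex \<Rightarrow> complex" where
  "K a b c d e u v p =
     (let \<sigma>1 = b + c + d + e;
          \<sigma>2 = b*c + b*d + b*e + c*d + c*e + d*e;
          \<sigma>3 = b*c*d + b*c*e + b*d*e + c*d*e;
          \<sigma>4 = b*c*d*e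
      in (u * v * (\<sigma>3 - a*\<sigma>1) * (p*\<sigma>3 - a*\<sigma>1) * a^2
          + (1 - p) * u * v * (a^2 - \<sigma>4) * (a^2 - \<sigma>2*a + \<sigma>4) * a
          + (u + v) * (a + u * v) * (\<sigma>3 - a*\<sigma>1) * (a^2 - p*\<sigma>4) * a
          + (u^2 + a) * (v^2 + a) * (a^2 - \<sigma>4) * (a^2 - p*\<sigma>4))
         / K_denom a b c d e u v p)"

end

theory Submission
  imports Defs
begin

text \<open>
  Put \<open>x\<^sub>j = q\<^sup>-\<^sup>j + a q\<^sup>j\<close>. Since \<open>(1 - u q\<^sup>j) (1 - a q\<^sup>j / u) = q\<^sup>j (x\<^sub>j - (u + a / u))\<close>, the Bailey sum is
  a combination of the moments \<open>S\<^sub>k(n) = \<Sum>j\<le>n. t(n,j) x\<^sub>j\<^sup>k\<close>, \<open>k \<le> 2\<close>, of the summand \<open>t\<close> of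
  Rogers' terminating very-well-poised \<open>6\<phi>5\<close> sum. The sum \<open>S\<^sub>0\<close> obeys a first-order recurrence in
  \<open>n\<close>, by creative telescoping. Because
  \<open>t(n,j) = t(n+1,j) (1 - q\<^sup>n\<^sup>+\<^sup>1\<^sup>-\<^sup>j) (1 - a q\<^sup>n\<^sup>+\<^sup>1\<^sup>+\<^sup>j) = t(n+1,j) (1 + a P\<^sup>2 - P x\<^sub>j)\<close> with \<open>P = q\<^sup>n\<^sup>+\<^sup>1\<close>, the
  higher moments satisfy \<open>P S\<^sub>k\<^sub>+\<^sub>1(n+1) = (1 + a P\<^sup>2) S\<^sub>k(n+1) - S\<^sub>k(n)\<close>, so \<open>S\<^sub>1\<close> and \<open>S\<^sub>2\<close> are
  explicit multiples of \<open>S\<^sub>0\<close>; these multiples are the coefficients in \<open>K\<close>.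
\<close>

section \<open>Elementary facts on q-Pochhammer symbols\<close>

lemma qpoch_0 [simp]: "qpoch x q 0 = 1"
  by (simp add: qpoch_def)

lemma qpoch_Suc: "qpoch x q (Suc n) = qpoch x q n * (1 - x * q ^ n)"
  by (simp add: qpoch_def)

text \<open>Both sides are (x;q)_(n+1), with the first or the last factor split off.\<close>

lemma qpoch_shift: "(1 - x) * qpoch (q * x) q n = qpoch x q n * (1 - x * q ^ n)"
proof (induction n)
  case (Suc n)
  have "(1 - x) * qpoch (q * x) q (Suc n) = ((1 - x) * qpoch (q * x) q n) * (1 - q * x * q ^ n)"
    by (simp add: qpoch_Suc)
  then show ?case
    unfolding Suc.IH by (simp add: qpoch_Suc mult_ac)
qed simp

lemma qpoch_shift_div:
  assumes "qpoch x q n \<noteq> 0" "x \<noteq> 1"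
  shows "qpoch (q * x) q n / qpoch x q n = (1 - x * q ^ n) / (1 - x)"
  using assms qpoch_shift[of x q n] by (simp add: field_simps)

lemma qpoch_nonzero_factor:
  assumes "\<And>n. qpoch x q n \<noteq> 0"
  shows "x * q ^ n \<noteq> 1"
  using assms[of "Suc n"] by (auto simp: qpoch_Suc)

lemma qpoch_nonzero:
  assumes "\<And>n. x * q ^ n \<noteq> 1"
  shows "qpoch x q n \<noteq> 0"
  using assms by (simp add: qpoch_def)

lemma triangular_Suc: "Suc j * (Suc j + 1) div 2 = j * (j + 1) div 2 + Suc j"
proof -
  have "Suc j * (Suc j + 1) = j * (j + 1) + Suc j * 2"
    by (simp add: algebra_simps)
  then show ?thesis
    by (metis div_mult_self1 zero_neq_numeral add.commute mult.commute)
qed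

section \<open>The very-well-poised summand and its term ratios\<close>

locale rogers_sum =
  fixes a b c q :: complex
  assumes nonzero: "q \<noteq> 0" "b \<noteq> 0" "c \<noteq> 0"
    and aq: "\<And>k. a * q ^ k \<noteq> 1"
    and qq: "\<And>k. q ^ Suc k \<noteq> 1"
    and aqb: "\<And>k. a * q ^ Suc k \<noteq> b"
    and aqc: "\<And>k. a * q ^ Suc k \<noteq> c"
begin

text \<open>This is alpha_j without its \<open>u\<close> and \<open>v\<close> pairs. Each pair
  contributes a factor \<open>q ^ j\<close>, which turns the exponent j(j-3)/2 into j(j+1)/2; the
  pair in plus and minus sqrt(a) has collapsed to the first quotient.\<close>

definition coef :: "nat \<Rightarrow> complex" where
  "coef j = (1 - a * q ^ (2 * j)) / (1 - a)
     * (qpoch a q j * qpoch b q j * qpoch c q j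
        / (qpoch (a * q / b) q j * qpoch (a * q / c) q j * qpoch q q j))
     * (- a / (b * c)) ^ j * q ^ (j * (j + 1) div 2)"

definition summand :: "nat \<Rightarrow> nat \<Rightarrow> complex" where
  "summand n j = coef j / (qpoch q q (n - j) * qpoch (a * q) q (n + j))"

definition node :: "nat \<Rightarrow> complex" where
  "node j = 1 / q ^ j + a * q ^ j"

definition moment :: "nat \<Rightarrow> nat \<Rightarrow> complex" where
  "moment k n = (\<Sum>j\<le>n. summand n j * node j ^ k)"

lemma qpoch_q_nonzero: "qpoch q q n \<noteq> 0"
  using qq by (intro qpoch_nonzero) simp

lemma qpoch_aq_nonzero: "qpoch (a * q) q n \<noteq> 0"
  using aq[of "Suc _"] by (intro qpoch_nonzero) (simp add: mult.assoc)

lemma qpoch_aqb_nonzero: "qpoch (a * q / b) q n \<noteq> 0"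
  using aqb nonzero by (intro qpoch_nonzero) (simp add: mult.assoc)

lemma qpoch_aqc_nonzero: "qpoch (a * q / c) q n \<noteq> 0"
  using aqc nonzero by (intro qpoch_nonzero) (simp add: mult.assoc)

text \<open>The ratio of consecutive terms, cross-multiplied: the denominators \<open>b\<close> and
  \<open>c\<close> of the last Pochhammer factors cancel against -a/(bc), and the triangular
  exponent grows by j+1.\<close>

lemma coef_Suc:
  "coef (Suc j) * ((1 - a * q ^ (2 * j)) * (1 - q * q ^ j) * (b - a * q * q ^ j) * (c - a * q * q ^ j))
   = - coef j * ((1 - a * q ^ (2 * Suc j)) * (1 - a * q ^ j) * (1 - b * q ^ j) * (1 - c * q ^ j)
       * a * q * q ^ j)"
proof -
  have *: "1 - a * q / b * q ^ j = (b - a * q * q ^ j) / b"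
    "1 - a * q / c * q ^ j = (c - a * q * q ^ j) / c"
    using nonzero by (simp_all add: field_simps)
  have ne: "b - a * q * q ^ j \<noteq> 0" "c - a * q * q ^ j \<noteq> 0" "1 - q * q ^ j \<noteq> 0" "1 - a \<noteq> 0"
    using aqb[of j] aqc[of j] qq[of j] aq[of 0] by (auto simp: mult.assoc)
  have "q ^ (Suc j * (Suc j + 1) div 2) = q ^ (j * (j + 1) div 2) * (q * q ^ j)"
    unfolding triangular_Suc power_add by simp
  then show ?thesis
    unfolding coef_def qpoch_Suc *
    using ne nonzero qpoch_aqb_nonzero[of j] qpoch_aqc_nonzero[of j] qpoch_q_nonzero[of j]
    by (simp add: divide_simps del: power_Suc mult_Suc_right) (simp add: ac_simps)
qed

lemma summand_Suc_left:
  assumes "j \<le> n"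
  shows "summand n j = summand (Suc n) j * ((1 - q * q ^ (n - j)) * (1 - a * q * q ^ (n + j)))"
proof -
  have ne: "1 - q * q ^ (n - j) \<noteq> 0" "1 - a * q * q ^ (n + j) \<noteq> 0"
    using qq[of "n - j"] aq[of "Suc (n + j)"] by (auto simp: mult.assoc)
  then show ?thesis
    using qpoch_q_nonzero[of "n - j"] qpoch_aq_nonzero[of "n + j"]
    by (simp add: summand_def Suc_diff_le[OF assms] qpoch_Suc divide_simps)
qed

section \<open>Creative telescoping for the zeroth moment\<close>

text \<open>The Zeilberger companion of the summand: a rational multiple of
  \<open>summand (Suc n) j\<close> whose differences in \<open>j\<close> give the recurrence in
  \<open>n\<close>. Its factor \<open>1 - q ^ j\<close> makes it vanish at j = 0.\<close>

definition certificate :: "nat \<Rightarrow> nat \<Rightarrow> complex" where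
  "certificate n j = - (q ^ (Suc n - j)) * (1 - q ^ j) * (b - a * q ^ j) * (c - a * q ^ j)
     * (1 - a * q * q ^ (n + j)) / (1 - a * q ^ (2 * j)) * summand (Suc n) j"

text \<open>Expressing the shifted certificate through the unshifted summand lets
  \<open>summand (Suc n) j\<close> be factored out of the telescoping relation, leaving a rational
  identity.\<close>

lemma certificate_Suc:
  assumes "j \<le> n"
  shows "certificate n (Suc j) = q ^ (n - j) * a * q * q ^ j * (1 - a * q ^ j) * (1 - b * q ^ j)
     * (1 - c * q ^ j) * (1 - q * q ^ (n - j)) / (1 - a * q ^ (2 * j)) * summand (Suc n) j"
proof -
  \<comment> \<open>\<open>w\<close> is the part of \<open>summand (Suc n) j\<close> outside
    \<open>coef\<close>. Passing to j+1 multiplies it by 1 - q^(n-j+1) and divides it by 1 - a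
    q^(n+j+2); the latter cancels a factor of the certificate.\<close>
  define w where "w = 1 / (qpoch q q (Suc n - j) * qpoch (a * q) q (Suc n + j))"
  have ne: "1 - q * q ^ (n - j) \<noteq> 0" "1 - a * q * q ^ Suc (n + j) \<noteq> 0"
    "1 - a * q ^ (2 * j) \<noteq> 0" "1 - a * q ^ (2 * Suc j) \<noteq> 0"
    using qq[of "n - j"] aq[of "Suc (Suc (n + j))"] aq[of "2 * j"] aq[of "2 * Suc j"]
    by (auto simp: mult.assoc)
  have 1: "summand (Suc n) (Suc j) * (1 - a * q * q ^ Suc (n + j))
      = w * (1 - q * q ^ (n - j)) * coef (Suc j)"
    using ne qpoch_q_nonzero[of "n - j"] qpoch_aq_nonzero[of "Suc (n + j)"]
    by (simp add: w_def summand_def Suc_diff_le[OF assms] qpoch_Suc[of _ _ "n - j"]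
          qpoch_Suc[of _ _ "Suc (n + j)"] divide_simps del: power_Suc)
  have 2: "summand (Suc n) j = w * coef j"
    by (simp add: w_def summand_def)
  have "certificate n (Suc j) * (1 - a * q ^ (2 * Suc j))
     = - (q ^ (n - j)) * (1 - q * q ^ j) * (b - a * q * q ^ j) * (c - a * q * q ^ j)
        * (summand (Suc n) (Suc j) * (1 - a * q * q ^ Suc (n + j)))"
    unfolding certificate_def using ne by (simp add: mult.assoc)
  then have "(1 - a * q ^ (2 * Suc j)) * (certificate n (Suc j) * (1 - a * q ^ (2 * j)))
     = - (q ^ (n - j)) * w * (1 - q * q ^ (n - j)) * (coef (Suc j) * ((1 - a * q ^ (2 * j))
         * (1 - q * q ^ j) * (b - a * q * q ^ j) * (c - a * q * q ^ j)))"
    unfolding 1 by (simp only: mult.assoc[symmetric] mult.commute[of _ "certificate n (Suc j)"])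
      (simp only: mult_ac)
  also have "\<dots> = (1 - a * q ^ (2 * Suc j)) * (q ^ (n - j) * a * q * q ^ j * (1 - a * q ^ j)
     * (1 - b * q ^ j) * (1 - c * q ^ j) * (1 - q * q ^ (n - j)) * (w * coef j))"
    unfolding coef_Suc by (simp add: ac_simps)
  finally have "certificate n (Suc j) * (1 - a * q ^ (2 * j))
     = q ^ (n - j) * a * q * q ^ j * (1 - a * q ^ j)
     * (1 - b * q ^ j) * (1 - c * q ^ j) * (1 - q * q ^ (n - j)) * (w * coef j)"
    by (rule mult_left_cancel[OF ne(4), THEN iffD1])
  then show ?thesis
    unfolding 2 using ne(3) by (simp add: field_simps)
qed

text \<open>The telescoping relation after removing the common summand and multiplying by
  \<open>1 - a * Q\<^sup>2\<close>, with \<open>Q\<close> for q^j and \<open>D\<close> for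
  q^(n-j).\<close>

lemma telescoping_identity:
  fixes Q D :: complex
  shows "(1 - a * Q\<^sup>2) * ((b - a * (q * Q * D)) * (c - a * (q * Q * D)) * (1 - q * Q * D)
      - (b * c - a * (q * Q * D)) * ((1 - q * D) * (1 - a * q * (Q * D * Q))))
    = D * a * q * Q * (1 - a * Q) * (1 - b * Q) * (1 - c * Q) * (1 - q * D)
      - - (q * D) * (1 - Q) * (b - a * Q) * (c - a * Q) * (1 - a * q * (Q * D * Q))"
  by algebra

lemma telescoping:
  assumes "j \<le> n"
  shows "(b - a * q ^ Suc n) * (c - a * q ^ Suc n) * (1 - q ^ Suc n) * summand (Suc n) j
      - (b * c - a * q ^ Suc n) * summand n j
    = certificate n (Suc j) - certificate n j"
proof -
  define Q where "Q = q ^ j"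
  define D where "D = q ^ (n - j)"
  have P: "q ^ Suc n = q * Q * D" "q ^ (n + j) = Q * D * Q" "q ^ (2 * j) = Q\<^sup>2"
      "q ^ (Suc n - j) = q * D"
    using assms by (simp_all add: Q_def D_def Suc_diff_le flip: power_add power_mult)
      (simp add: mult.commute)
  have ne: "1 - a * Q\<^sup>2 \<noteq> 0"
    using aq[of "2 * j"] P by auto
  \<comment> \<open>Restores the denominator \<open>k\<close>, here
    \<open>1 - a * Q\<^sup>2\<close>, and the common factor \<open>s\<close>, here
    \<open>summand (Suc n) j\<close>.\<close>
  have fraction: "l * s - m * (s * z) = r / k * s - r' / k * s"
    if "k * (l - m * z) = r - r'" "k \<noteq> 0" for k l m z r r' s :: complex
  proof -
    have "l - m * z = r / k - r' / k"
      using that by (metis diff_divide_distrib nonzero_mult_div_cancel_left)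
    moreover have "l * s - m * (s * z) = (l - m * z) * s"
      by (simp add: algebra_simps)
    ultimately show ?thesis
      by (simp only: left_diff_distrib)
  qed
  show ?thesis
    unfolding certificate_Suc[OF assms] summand_Suc_left[OF assms]
    unfolding certificate_def P
    unfolding Q_def[symmetric] D_def[symmetric]
    by (rule fraction[OF telescoping_identity ne])
qed

lemma moment_0_Suc:
  "(b - a * q ^ Suc n) * (c - a * q ^ Suc n) * (1 - q ^ Suc n) * moment 0 (Suc n)
   = (b * c - a * q ^ Suc n) * moment 0 n"
proof -
  let ?L = "(b - a * q ^ Suc n) * (c - a * q ^ Suc n) * (1 - q ^ Suc n)"
  let ?M = "b * c - a * q ^ Suc n"
  \<comment> \<open>At j = n+1 the denominator of the certificate equals one of its numerator
    factors, so the upper boundary term cancels the extra summand of the longer sum.\<close>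
  have "1 - a * q ^ (2 * Suc n) \<noteq> 0"
    using aq[of "2 * Suc n"] by auto
  moreover have "a * q * q ^ (n + Suc n) = a * q ^ (2 * Suc n)"
    by (simp add: mult_2 power_add)
  ultimately have "certificate n (Suc n)
      = - ((1 - q ^ Suc n) * (b - a * q ^ Suc n) * (c - a * q ^ Suc n) * summand (Suc n) (Suc n))"
    by (simp only: certificate_def diff_self_eq_0 power_0 nonzero_mult_div_cancel_right not_False_eq_True
        mult_minus_left mult_1_left minus_divide_left[symmetric])
  then have last: "?L * summand (Suc n) (Suc n) = - certificate n (Suc n)"
    by (simp only: minus_minus ac_simps)
  have "?L * moment 0 (Suc n) - ?M * moment 0 n
    = (\<Sum>j\<le>n. ?L * summand (Suc n) j - ?M * summand n j) + ?L * summand (Suc n) (Suc n)"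
    by (simp add: moment_def sum_subtractf sum_distrib_left distrib_left)
  also have "(\<Sum>j\<le>n. ?L * summand (Suc n) j - ?M * summand n j)
    = (\<Sum>j\<le>n. certificate n (Suc j) - certificate n j)"
    by (intro sum.cong refl telescoping) simp
  also have "\<dots> = certificate n (Suc n) - certificate n 0"
    unfolding lessThan_Suc_atMost[symmetric] by (rule sum_lessThan_telescope)
  also have "certificate n 0 = 0"
    by (simp add: certificate_def)
  finally show ?thesis
    using last by simp
qed

section \<open>Recurrence for higher moments and closed forms\<close>

lemma moment_0: "moment k 0 = (1 + a) ^ k"
  using aq[of 0] by (simp add: moment_def summand_def coef_def node_def)

lemma moment_Suc_Suc:
  "q ^ Suc n * moment (Suc k) (Suc n) = (1 + a * (q ^ Suc n)\<^sup>2) * moment k (Suc n) - moment k n"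
proof -
  let ?P = "q ^ Suc n"
  have node: "?P * node j = 1 + a * ?P\<^sup>2 - (1 - q ^ (Suc n - j)) * (1 - a * q ^ (Suc n + j))"
    if "j \<le> Suc n" for j
  proof -
    have "?P = q ^ j * q ^ (Suc n - j)" "q ^ (Suc n + j) = ?P * q ^ j"
      using that by (simp_all only: flip: power_add) simp
    then show ?thesis
      using nonzero(1) by (simp add: node_def power2_eq_square algebra_simps del: power_Suc)
  qed
  have "?P * moment (Suc k) (Suc n) = (\<Sum>j\<le>Suc n. summand (Suc n) j * node j ^ k * (?P * node j))"
    by (simp add: moment_def sum_distrib_left ac_simps del: sum.atMost_Suc)
  also have "\<dots> = (\<Sum>j\<le>Suc n. (1 + a * ?P\<^sup>2) * (summand (Suc n) j * node j ^ k)
      - summand (Suc n) j * ((1 - q ^ (Suc n - j)) * (1 - a * q ^ (Suc n + j))) * node j ^ k)"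
    by (intro sum.cong refl) (simp only: node atMost_iff, simp only: algebra_simps)
  also have "\<dots> = (1 + a * ?P\<^sup>2) * moment k (Suc n)
     - (\<Sum>j\<le>Suc n. summand (Suc n) j * ((1 - q ^ (Suc n - j)) * (1 - a * q ^ (Suc n + j))) * node j ^ k)"
    by (simp only: sum_subtractf moment_def sum_distrib_left)
  \<comment> \<open>The term j = n+1 drops out because of its factor 1 - q^0.\<close>
  also have "(\<Sum>j\<le>Suc n. summand (Suc n) j * ((1 - q ^ (Suc n - j)) * (1 - a * q ^ (Suc n + j))) * node j ^ k)
     = (\<Sum>j\<le>n. summand (Suc n) j * ((1 - q ^ (Suc n - j)) * (1 - a * q ^ (Suc n + j))) * node j ^ k)"
    by simp
  also have "\<dots> = moment k n"
    unfolding moment_def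
    by (intro sum.cong refl) (subst summand_Suc_left, simp_all add: Suc_diff_le mult.assoc)
  finally show ?thesis .
qed

text \<open>Rogers' terminating sum, obtained by iterating the first-order recurrence from the value
  1 at n = 0.\<close>

lemma moment_0_closed_form:
  "moment 0 n = qpoch (a * q / (b * c)) q n / (qpoch (a * q / b) q n * qpoch (a * q / c) q n * qpoch q q n)"
proof (induction n)
  case 0
  then show ?case by (simp add: moment_0)
next
  case (Suc n)
  have ne: "b - a * q ^ Suc n \<noteq> 0" "c - a * q ^ Suc n \<noteq> 0" "1 - q ^ Suc n \<noteq> 0"
    using aqb[of n] aqc[of n] qq[of n] by auto
  have *: "1 - a * q / b * q ^ n = (b - a * q ^ Suc n) / b"
    "1 - a * q / c * q ^ n = (c - a * q ^ Suc n) / c"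
    "1 - a * q / (b * c) * q ^ n = (b * c - a * q ^ Suc n) / (b * c)"
    "1 - q * q ^ n = 1 - q ^ Suc n"
    using nonzero by (simp_all add: field_simps)
  have "moment 0 (Suc n)
    = (b * c - a * q ^ Suc n) / ((b - a * q ^ Suc n) * (c - a * q ^ Suc n) * (1 - q ^ Suc n)) * moment 0 n"
    using moment_0_Suc[of n] ne by (simp add: divide_simps ac_simps del: power_Suc)
  then show ?case
    unfolding Suc.IH qpoch_Suc * using nonzero ne by (simp add: divide_simps ac_simps del: power_Suc)
qed

text \<open>
  With \<open>\<sigma>\<^sub>i\<close> the elementary symmetric functions of \<open>b, c, 1/N, a\<close>, we have \<open>E\<^sub>1 N = N (\<sigma>\<^sub>3 - a \<sigma>\<^sub>1)\<close>, and
  \<open>a\<^sup>2 E\<^sub>2 N / N\<^sup>2\<close> is the coefficient of \<open>u v\<close> formed by the first two terms of the numerator of \<open>K\<close>.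
\<close>

definition E\<^sub>1 :: "complex \<Rightarrow> complex" where
  "E\<^sub>1 N = b*c + a*b*c*N + a*b + a*c - a*b*N - a*c*N - a - a\<^sup>2*N"

definition E\<^sub>2 :: "complex \<Rightarrow> complex" where
  "E\<^sub>2 N = E\<^sub>1 N * (q * (b*c + a*b*c*N + a*b + a*c) - a * (b*N + c*N + 1 + a*N))
     + (1 - q) * (a*N - b*c) * (a\<^sup>2*N - a * (b*c*N + b + a*b*N + c + a*c*N + a) + a*b*c)"

text \<open>\<open>moment 0 m\<close> is eliminated between the recurrence raising \<open>k\<close>
  and the one in \<open>n\<close>; a factor \<open>P\<close> then splits off from the coefficient of
  \<open>moment 0 (Suc m)\<close>.\<close>

lemma moment_1: "(b * c - a * q ^ n) * moment 1 n = E\<^sub>1 (q ^ n) * moment 0 n"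
proof (cases n)
  case 0
  then show ?thesis
    by (simp add: moment_0 E\<^sub>1_def power2_eq_square algebra_simps)
next
  case (Suc m)
  define P where "P = q ^ Suc m"
  have "P \<noteq> 0" using nonzero by (simp add: P_def)
  moreover have "P * ((b * c - a * P) * moment 1 (Suc m)) = P * (E\<^sub>1 P * moment 0 (Suc m))"
    using moment_Suc_Suc[of m 0] moment_0_Suc[of m]
    unfolding P_def[symmetric] E\<^sub>1_def One_nat_def by algebra
  ultimately show ?thesis
    by (simp add: Suc P_def)
qed

lemma moment_2:
  "(b * c - a * q ^ n) * (q * b * c - a * q ^ n) * moment 2 n = E\<^sub>2 (q ^ n) * moment 0 n"
proof (cases n)
  case 0
  show ?thesis
    unfolding 0 moment_0 E\<^sub>1_def E\<^sub>2_def power_0 by algebra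
next
  case (Suc m)
  define N where "N = q ^ m"
  have P: "q ^ Suc m = q * N" by (simp add: N_def)
  have "q * N \<noteq> 0"
    using nonzero by (simp add: N_def)
  have m2: "(q * N) * moment 2 (Suc m) = (1 + a * (q * N)\<^sup>2) * moment 1 (Suc m) - moment 1 m"
    using moment_Suc_Suc[of m 1] unfolding P by (simp add: numeral_2_eq_2)
  have r: "(b - a * (q * N)) * (c - a * (q * N)) * (1 - q * N) * moment 0 (Suc m)
      = (b * c - a * (q * N)) * moment 0 m"
    using moment_0_Suc[of m] unfolding P .
  have s: "(b * c - a * (q * N)) * moment 1 (Suc m) = E\<^sub>1 (q * N) * moment 0 (Suc m)"
    using moment_1[of "Suc m"] unfolding P .
  have s': "(b * c - a * N) * moment 1 m = E\<^sub>1 N * moment 0 m"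
    using moment_1[of m] by (simp add: N_def)
  \<comment> \<open>For n = m+1 the second factor \<open>q * b * c - a * (q * N)\<close> is
    \<open>q * (b * c - a * N)\<close>, exactly what clears the denominator of
    \<open>moment 1 m\<close>.\<close>
  have "(q * N) * ((b * c - a * (q * N)) * (q * b * c - a * (q * N)) * moment 2 (Suc m))
     = q * ((b * c - a * N) * (1 + a * (q * N)\<^sup>2) * ((b * c - a * (q * N)) * moment 1 (Suc m))
       - (b * c - a * (q * N)) * ((b * c - a * N) * moment 1 m))"
    using m2 by algebra
  also have "\<dots> = q * ((b * c - a * N) * (1 + a * (q * N)\<^sup>2) * E\<^sub>1 (q * N)
       - (b - a * (q * N)) * (c - a * (q * N)) * (1 - q * N) * E\<^sub>1 N) * moment 0 (Suc m)"
    unfolding s s' by (simp only: mult.left_commute[of _ "E\<^sub>1 N"] flip: r) (simp only: algebra_simps)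
  also have "\<dots> = (q * N) * (E\<^sub>2 (q * N) * moment 0 (Suc m))"
    unfolding E\<^sub>2_def E\<^sub>1_def by algebra
  finally show ?thesis
    using \<open>q * N \<noteq> 0\<close> unfolding Suc P by simp
qed

section \<open>The function K as a quadratic combination of moments\<close>

lemma K_conv_E:
  assumes "a \<noteq> 0" "u \<noteq> 0" "v \<noteq> 0" "N \<noteq> 0"
  defines "U \<equiv> u + a / u" and "V \<equiv> v + a / v"
  shows "K a b c (1 / N) a u v q
    = (E\<^sub>2 N + (U + V) * (E\<^sub>1 N * (a * N - q * b * c)) + U * V * ((a * N - b * c) * (a * N - q * b * c)))
      / ((a * N - b * c) * (a * N - q * b * c) * ((1 - u) * (1 - a / u) * ((1 - v) * (1 - a / v))))"
proof -
  define d where "d = 1 / N"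
  define \<sigma>1 where "\<sigma>1 = b + c + d + a"
  define \<sigma>2 where "\<sigma>2 = b*c + b*d + b*a + c*d + c*a + d*a"
  define \<sigma>3 where "\<sigma>3 = b*c*d + b*c*a + b*d*a + c*d*a"
  define \<sigma>4 where "\<sigma>4 = b*c*d*a"
  define F where "F = q * (b*c + a*b*c*N + a*b + a*c) - a * (b*N + c*N + 1 + a*N)"
  define G where "G = a\<^sup>2*N - a * (b*c*N + b + a*b*N + c + a*c*N + a) + a*b*c"
  define f where "f = a * N - b * c"
  define g where "g = a * N - q * b * c"
  have "d \<noteq> 0" and Nd: "N * d = 1" using assms by (simp_all add: d_def)
  \<comment> \<open>Each combination is affine in d = 1/N, hence \<open>d\<close> times a polynomial
    in \<open>N\<close>.\<close>
  have s: "\<sigma>3 - a * \<sigma>1 = d * E\<^sub>1 N" "q * \<sigma>3 - a * \<sigma>1 = d * F" "a\<^sup>2 - \<sigma>4 = d * a * f"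
    "a\<^sup>2 - q * \<sigma>4 = d * a * g" "a\<^sup>2 - \<sigma>2 * a + \<sigma>4 = d * G" "a\<^sup>2 - \<sigma>4 * q = d * a * g"
    unfolding \<sigma>1_def \<sigma>2_def \<sigma>3_def \<sigma>4_def E\<^sub>1_def F_def G_def f_def g_def
    using Nd by algebra+
  have w: "(u + v) * (a + u * v) = u * v * (U + V)" "u\<^sup>2 + a = u * U" "v\<^sup>2 + a = v * V"
    "a - u = - u * (1 - a / u)" "a - v = - v * (1 - a / v)"
    using assms by (simp_all add: U_def V_def field_simps power2_eq_square)
  have "K a b c d a u v q
    = (u * v * (d * E\<^sub>1 N) * (d * F) * a\<^sup>2 + (1 - q) * u * v * (d * a * f) * (d * G) * a
       + u * v * (U + V) * (d * E\<^sub>1 N) * (d * a * g) * a + (u * U) * (v * V) * (d * a * f) * (d * a * g))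
      / (d * a * f * (d * a * g) * (1 - u) * (- u * (1 - a / u)) * (1 - v) * (- v * (1 - a / v)))"
    unfolding K_def Let_def K_denom_def \<sigma>1_def[symmetric] \<sigma>2_def[symmetric] \<sigma>3_def[symmetric]
      \<sigma>4_def[symmetric] s w ..
  \<comment> \<open>Every term of the numerator, and the denominator, carries the common factor
    \<open>u * v * (d * a)\<^sup>2\<close>.\<close>
  also have "\<dots> = (u * v * (d * a)\<^sup>2 * (E\<^sub>1 N * F + (1 - q) * f * G + (U + V) * (E\<^sub>1 N * g) + U * V * (f * g)))
      / (u * v * (d * a)\<^sup>2 * (f * g * ((1 - u) * (1 - a / u) * ((1 - v) * (1 - a / v)))))"
    by (rule arg_cong2[where f = "(/)"]) algebra+
  also have "\<dots> = (E\<^sub>1 N * F + (1 - q) * f * G + (U + V) * (E\<^sub>1 N * g) + U * V * (f * g))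
      / (f * g * ((1 - u) * (1 - a / u) * ((1 - v) * (1 - a / v))))"
    using assms \<open>d \<noteq> 0\<close> by (intro mult_divide_mult_cancel_left) simp
  finally show ?thesis
    by (simp add: d_def E\<^sub>2_def F_def G_def f_def g_def)
qed

lemma K_conv_moments:
  assumes "a \<noteq> 0" "u \<noteq> 0" "v \<noteq> 0" "a * q ^ n \<noteq> b * c" "a * q ^ n \<noteq> q * b * c"
  defines "U \<equiv> u + a / u" and "V \<equiv> v + a / v"
  shows "K a b c (q powi (- int n)) a u v q * moment 0 n
    = (moment 2 n - (U + V) * moment 1 n + U * V * moment 0 n)
        / ((1 - u) * (1 - a / u) * ((1 - v) * (1 - a / v)))"
proof -
  define N where "N = q ^ n"
  define f where "f = a * N - b * c"
  define g where "g = a * N - q * b * c"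
  define X where "X = (1 - u) * (1 - a / u) * ((1 - v) * (1 - a / v))"
  have ne: "N \<noteq> 0" "f \<noteq> 0" "g \<noteq> 0"
    using assms(4,5) nonzero by (auto simp: N_def f_def g_def)
  have "E\<^sub>1 N * moment 0 n = - f * moment 1 n"
    using moment_1[of n] by (simp add: N_def f_def)
  moreover have "E\<^sub>2 N * moment 0 n = f * g * moment 2 n"
    using moment_2[of n] unfolding N_def[symmetric] f_def g_def by algebra
  ultimately have "(E\<^sub>2 N + (U + V) * (E\<^sub>1 N * g) + U * V * (f * g)) * moment 0 n
      = f * g * (moment 2 n - (U + V) * moment 1 n + U * V * moment 0 n)"
    by algebra
  moreover have "K a b c (q powi (- int n)) a u v q
      = (E\<^sub>2 N + (U + V) * (E\<^sub>1 N * g) + U * V * (f * g)) / (f * g * X)"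
    using K_conv_E[OF assms(1-3) ne(1)]
    by (simp add: N_def f_def g_def X_def U_def V_def power_int_minus inverse_eq_divide)
  ultimately show ?thesis
    using ne by (simp add: X_def[symmetric])
qed

section \<open>Back to the sequences alpha and beta\<close>

lemma sum_quadratic_node:
  "(\<Sum>j\<le>n. summand n j * ((node j - U) * (node j - V)))
     = moment 2 n - (U + V) * moment 1 n + U * V * moment 0 n"
  by (simp add: moment_def sum_distrib_left power2_eq_square algebra_simps
        flip: sum.distrib sum_subtractf)

text \<open>Each shifted quotient telescopes to its end factors, and the product of the two linear
  factors in q^j is symmetric under exchanging x and a/x, so it depends on x only through x +
  a/x.\<close>

lemma qpoch_pair_ratio:
  assumes "x \<noteq> 0" "\<And>n. qpoch x q n \<noteq> 0" "\<And>n. qpoch (a / x) q n \<noteq> 0"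
  shows "qpoch (q * x) q j / qpoch x q j * (qpoch (q * a / x) q j / qpoch (a / x) q j)
    = q ^ j * (node j - (x + a / x)) / ((1 - x) * (1 - a / x))"
proof -
  have "x \<noteq> 1" "a / x \<noteq> 1"
    using qpoch_nonzero_factor[OF assms(2), of 0] qpoch_nonzero_factor[OF assms(3), of 0] by auto
  then have "qpoch (q * x) q j / qpoch x q j * (qpoch (q * (a / x)) q j / qpoch (a / x) q j)
     = (1 - x * q ^ j) / (1 - x) * ((1 - a / x * q ^ j) / (1 - a / x))"
    using qpoch_shift_div[OF assms(2)[of j]] qpoch_shift_div[OF assms(3)[of j]] by metis
  moreover have "(1 - x * q ^ j) * (1 - a / x * q ^ j) = q ^ j * (node j - (x + a / x))"
    using assms nonzero by (simp add: node_def field_simps)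
  ultimately show ?thesis
    by simp
qed

end

text \<open>The two factors \<open>q ^ n\<close> are those produced by the \<open>u\<close> and
  \<open>v\<close> pairs. An integer power is required because the exponent is -1 for n = 1 and n =
  2.\<close>

lemma power_int_triangular:
  fixes q :: complex
  assumes "q \<noteq> 0"
  shows "q powi (int n * (int n - 3) div 2) * (q ^ n * q ^ n) = q ^ (n * (n + 1) div 2)"
proof -
  have "int n * (int n - 3) = int (n * (n + 1)) + (- 2 * int n) * 2"
    by (simp add: algebra_simps)
  then have e: "int n * (int n - 3) div 2 = int (n * (n + 1) div 2) - int (n + n)"
    by (simp only: div_mult_self1 zdiv_int) simp
  show ?thesis
    unfolding e power_int_diff[OF disjI1[OF assms]] power_int_of_nat power_add[of q n n]
    using assms by simp
qed

theorem theorem2p1: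
  fixes a b c u v q :: complex
  assumes "q \<noteq> 0" and "b \<noteq> 0" and "c \<noteq> 0" and "u \<noteq> 0" and "v \<noteq> 0"
    and "\<And>n. qpochs [csqrt a, - csqrt a, q*a/b, q*a/c, u, a/u, v, a/v, q] q n \<noteq> 0"
    and "\<And>n. qpoch (a*q) q n \<noteq> 0"
    and "\<And>n::nat. K_denom a b c (q powi (- int n)) a u v q \<noteq> 0"
  shows "bailey_pair a q
    (\<lambda>n. qpochs [q * csqrt a, - q * csqrt a, a, b, c, q*u, q*a/u, q * v, q*a/v] q n
         / qpochs [csqrt a, - csqrt a, q*a/b, q*a/c, u, a/u, v, a/v, q] q n
         * (- a / (b*c)) ^ n * q powi (int n * (int n - 3) div 2))
    (\<lambda>n. K a b c (q powi (- int n)) a u v q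
         * (qpoch (a*q/(b*c)) q n / qpochs [a*q/b, a*q/c, q] q n))"
proof -
  have ne: "qpoch (csqrt a) q n \<noteq> 0" "qpoch (- csqrt a) q n \<noteq> 0" "qpoch (q * a / b) q n \<noteq> 0"
    "qpoch (q * a / c) q n \<noteq> 0" "qpoch u q n \<noteq> 0" "qpoch (a / u) q n \<noteq> 0" "qpoch v q n \<noteq> 0"
    "qpoch (a / v) q n \<noteq> 0" "qpoch q q n \<noteq> 0" for n
    using assms(6)[of n] by (simp_all add: qpochs_def)
  have s1: "csqrt a \<noteq> 1" "- csqrt a \<noteq> 1"
    using qpoch_nonzero_factor[OF ne(1), of 0] qpoch_nonzero_factor[OF ne(2), of 0] by simp_all
  have ss: "csqrt a * csqrt a = a"
    by (metis power2_csqrt power2_eq_square)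
  \<comment> \<open>If a = 1, the principal root would be 1, which \<open>s1\<close>
    excludes.\<close>
  have a1: "a \<noteq> 1"
    using s1 ss by (metis csqrt_1)
  have "a * q ^ k \<noteq> 1" for k
    using a1 qpoch_nonzero_factor[OF assms(7), of "k - 1"] by (cases k) (simp_all add: mult.assoc)
  moreover have "q ^ Suc k \<noteq> 1" for k
    using qpoch_nonzero_factor[OF ne(9), of k] by simp
  moreover have "a * q ^ Suc k \<noteq> b" "a * q ^ Suc k \<noteq> c" for k
    using qpoch_nonzero_factor[OF ne(3), of k] qpoch_nonzero_factor[OF ne(4), of k] assms(2,3)
    by (auto simp: field_simps)
  ultimately interpret rogers_sum a b c q
    using assms(1-3) by unfold_locales
  \<comment> \<open>The factor a^2 - bcda of \<open>K_denom\<close> is divisible by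
    \<open>a\<close>.\<close>
  have a0: "a \<noteq> 0"
    using assms(8)[of 0] by (auto simp: K_denom_def)
  have bc: "a * q ^ n \<noteq> b * c" "a * q ^ n \<noteq> q * b * c" for n
  proof -
    define d where "d = q powi (- int n)"
    have d: "q ^ n * d = 1"
      using assms(1) by (simp add: d_def power_int_minus)
    have K: "a^2 - b*c*d*a \<noteq> 0" "a^2 - b*c*d*a*q \<noteq> 0"
      using assms(8)[of n] by (auto simp: K_denom_def d_def)
    show "a * q ^ n \<noteq> b * c"
    proof
      assume "a * q ^ n = b * c"
      then have "b*c*d*a = a * (q ^ n * d) * a" by (simp add: mult_ac)
      with K(1) d show False by (simp add: power2_eq_square)
    qed
    show "a * q ^ n \<noteq> q * b * c"
    proof
      assume "a * q ^ n = q * b * c"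
      then have "b*c*d*a*q = a * (q ^ n * d) * a" by (simp add: mult_ac)
      with K(2) d show False by (simp add: power2_eq_square)
    qed
  qed
  let ?\<alpha> = "\<lambda>n. qpochs [q * csqrt a, - q * csqrt a, a, b, c, q*u, q*a/u, q * v, q*a/v] q n
         / qpochs [csqrt a, - csqrt a, q*a/b, q*a/c, u, a/u, v, a/v, q] q n
         * (- a / (b*c)) ^ n * q powi (int n * (int n - 3) div 2)"
  define U where "U = u + a / u"
  define V where "V = v + a / v"
  define X where "X = (1 - u) * (1 - a / u) * ((1 - v) * (1 - a / v))"
  have \<alpha>: "?\<alpha> j = coef j * ((node j - U) * (node j - V)) / X" for j
  proof -
    \<comment> \<open>The pair in plus and minus sqrt(a) yields the very-well-poised factor.\<close>
    have "qpoch (q * csqrt a) q j / qpoch (csqrt a) q j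
        * (qpoch (q * - csqrt a) q j / qpoch (- csqrt a) q j)
      = (1 - csqrt a * q ^ j) / (1 - csqrt a) * ((1 - - csqrt a * q ^ j) / (1 - - csqrt a))"
      using qpoch_shift_div[OF ne(1) s1(1), of j] qpoch_shift_div[OF ne(2) s1(2), of j] by metis
    also have "\<dots> = (1 - (csqrt a * csqrt a) * (q ^ j * q ^ j)) / (1 - csqrt a * csqrt a)"
      by (simp add: algebra_simps)
    also have "\<dots> = (1 - a * q ^ (2 * j)) / (1 - a)"
      by (simp only: ss mult_2 power_add)
    finally have root: "qpoch (q * csqrt a) q j / qpoch (csqrt a) q j
        * (qpoch (q * - csqrt a) q j / qpoch (- csqrt a) q j) = (1 - a * q ^ (2 * j)) / (1 - a)" .
    have "?\<alpha> j = qpoch (q * csqrt a) q j / qpoch (csqrt a) q j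
        * (qpoch (q * - csqrt a) q j / qpoch (- csqrt a) q j)
       * (qpoch (q * u) q j / qpoch u q j * (qpoch (q * a / u) q j / qpoch (a / u) q j))
       * (qpoch (q * v) q j / qpoch v q j * (qpoch (q * a / v) q j / qpoch (a / v) q j))
       * (qpoch a q j * qpoch b q j * qpoch c q j
          / (qpoch (a * q / b) q j * qpoch (a * q / c) q j * qpoch q q j))
       * (- a / (b * c)) ^ j * q powi (int j * (int j - 3) div 2)"
      by (simp add: qpochs_def mult_ac)
    also have "\<dots> = coef j * ((node j - U) * (node j - V)) / X"
      unfolding root qpoch_pair_ratio[OF assms(4) ne(5,6)] qpoch_pair_ratio[OF assms(5) ne(7,8)]
        coef_def power_int_triangular[OF assms(1), symmetric] U_def V_def X_def
      by (simp add: mult_ac)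
    finally show ?thesis .
  qed
  have "?\<alpha> 0 = 1"
    by (simp add: qpochs_def)
  moreover have "K a b c (q powi (- int n)) a u v q
         * (qpoch (a*q/(b*c)) q n / qpochs [a*q/b, a*q/c, q] q n)
      = (\<Sum>j\<le>n. ?\<alpha> j / (qpoch q q (n - j) * qpoch (a * q) q (n + j)))" for n
  proof -
    have "K a b c (q powi (- int n)) a u v q
         * (qpoch (a*q/(b*c)) q n / qpochs [a*q/b, a*q/c, q] q n)
      = K a b c (q powi (- int n)) a u v q * moment 0 n"
      by (simp add: moment_0_closed_form qpochs_def mult.assoc)
    also have "\<dots> = (moment 2 n - (U + V) * moment 1 n + U * V * moment 0 n) / X"
      unfolding U_def V_def X_def by (rule K_conv_moments[OF a0 assms(4,5) bc])
    also have "\<dots> = (\<Sum>j\<le>n. summand n j * ((node j - U) * (node j - V)) / X)"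
      by (simp only: sum_quadratic_node flip: sum_divide_distrib)
    also have "\<dots> = (\<Sum>j\<le>n. ?\<alpha> j / (qpoch q q (n - j) * qpoch (a * q) q (n + j)))"
      unfolding \<alpha> summand_def by (simp add: mult_ac)
    finally show ?thesis .
  qed
  ultimately show ?thesis
    unfolding bailey_pair_def by blast
qed

end
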